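(* Let $\mathcal{H}$ be a real Hilbert space, let $M\subset\mathcal{H}$ be a nonempty set, and let $(x^k)_{k\in\mathbb{N}}\subset\mathcal{H}$ be a sequence that is Fejér* monotone with respect to $M$. Then $(x^k)_{k\in\mathbb{N}}$ is a quasi-Fejér of Type III sequence with respect to $M$.
   Context: $\mathbb{N}$ denotes the set of nonnegative integers. A sequence $(x^k)_{k\in\mathbb{N}}$ in a real Hilbert space $\mathcal{H}$ is Fejér* monotone with respect to a nonempty set $M\subset\mathcal{H}$ if for every $x\in M$ there exists $N(x)\in\mathbb{N}$ such that $\|x^{k+1}-x\|\le\|x^k-x\|$ for all $k\ge N(x)$. Let $\ell_+$ be the set of real sequences with nonnegative entries and $\ell^1$ the set of real sequences with finite $\ell_1$-norm (absolutely summable). The sequence $(x^k)_{k\in\mathbb{N}}$ is quasi-Fejér of Type III with respect to $M$ if for all $x\in M$ there exists a sequence $(\varepsilon_k)_{k\in\mathbb{N}}\in\ell_+\cap\ell^1$ (possibly depending on $x$) such that $\|x^{k+1}-x\|^2\le\|x^k-x\|^2+\varepsilon_k$ for all $k\in\mathbb{N}$. *)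

theory Defs
  imports "HOL-Analysis.Analysis"
begin

definition fejer_star_monotone :: "(nat \<Rightarrow> 'a::{real_inner, complete_space}) \<Rightarrow> 'a set \<Rightarrow> bool"
  where "fejer_star_monotone x M \<longleftrightarrow>
    (\<forall>z\<in>M. \<exists>N. \<forall>k\<ge>N. norm (x (Suc k) - z) \<le> norm (x k - z))"

definition ell_plus :: "(nat \<Rightarrow> real) set"
  where "ell_plus = {\<epsilon>. \<forall>k. 0 \<le> \<epsilon> k}"

definition ell_one :: "(nat \<Rightarrow> real) set"
  where "ell_one = {\<epsilon>. summable (\<lambda>k. \<bar>\<epsilon> k\<bar>)}"

definition quasi_fejer_III :: "(nat \<Rightarrow> 'a::{real_inner, complete_space}) \<Rightarrow> 'a set \<Rightarrow> bool"
  where "quasi_fejer_III x M \<longleftrightarrow>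
    (\<forall>z\<in>M. \<exists>\<epsilon> \<in> ell_plus \<inter> ell_one.
       \<forall>k. (norm (x (Suc k) - z))\<^sup>2 \<le> (norm (x k - z))\<^sup>2 + \<epsilon> k)"

end

theory Submission
  imports Defs
begin

text \<open>
  For a fixed point \<open>z\<close> of \<open>M\<close>, the distance to \<open>z\<close> can increase only at the finitely many
  indices below the threshold \<open>N\<close> that Fejer* monotonicity attaches to \<open>z\<close>. An error sequence that
  absorbs these increases and vanishes from \<open>N\<close> on is finitely supported, hence summable. The
  threshold varies with \<open>z\<close>, and so do the errors, as the Type III notion allows.
\<close>

theorem theorem4p2:
  fixes x :: "nat \<Rightarrow> 'a::{real_inner, complete_space}"
    and M :: "'a set"
  assumes "M \<noteq> {}"
    and "fejer_star_monotone x M"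
  shows "quasi_fejer_III x M"
  unfolding quasi_fejer_III_def
proof
  fix z
  assume "z \<in> M"
  then obtain N where N: "norm (x (Suc k) - z) \<le> norm (x k - z)" if "k \<ge> N" for k
    using assms(2) unfolding fejer_star_monotone_def by blast
  \<comment> \<open>Below \<open>N\<close> the whole new squared distance serves as the error: only finiteness of the
    support matters, and this choice is visibly nonnegative.\<close>
  define \<epsilon> where "\<epsilon> k = (if k < N then (norm (x (Suc k) - z))\<^sup>2 else 0)" for k
  have "\<epsilon> \<in> ell_plus"
    by (simp add: ell_plus_def \<epsilon>_def)
  moreover have "\<epsilon> \<in> ell_one"
    unfolding ell_one_def mem_Collect_eq
    by (rule summable_finite[of "{..<N}"]) (auto simp: \<epsilon>_def)
  moreover have "(norm (x (Suc k) - z))\<^sup>2 \<le> (norm (x k - z))\<^sup>2 + \<epsilon> k" for k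
    using N[of k] by (simp add: \<epsilon>_def power_mono)
  ultimately show "\<exists>\<epsilon> \<in> ell_plus \<inter> ell_one.
      \<forall>k. (norm (x (Suc k) - z))\<^sup>2 \<le> (norm (x k - z))\<^sup>2 + \<epsilon> k"
    by blast
qed

end
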